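(* Let $X$ be a Banach space such that $\epsilon_0(X)<1$, let $K\subset X$ be a nonempty, closed, bounded, and convex subset, and let $T\colon K\to K$ be of asymptotically Hölder nonexpansive type. If $T^N$ is continuous for some integer $N\ge1$, then $T$ has a fixed point in $K$.
   Context: The modulus of convexity of a Banach space $X$ is $\delta_X\colon[0,2]\to[0,1]$, $\delta_X(\epsilon)=\inf\{1-\|\frac{x+y}{2}\| : \|x\|\le 1,\ \|y\|\le 1,\ \|x-y\|\ge\epsilon\}$. The characteristic of convexity of $X$ is $\epsilon_0(X)=\sup\{\epsilon\in[0,2]:\delta_X(\epsilon)=0\}$. Let $K$ be a nonempty subset of $X$. A mapping $T\colon K\to K$ (not assumed continuous) is of asymptotically Hölder nonexpansive type if there exists a sequence $(\alpha_n)\subset(0,1]$ with $\alpha_n\to1$ such that, for every $x\in K$, $\limsup_{n\to\infty}\sup_{y\in K}\left(\|T^n x-T^n y\|-\|x-y\|^{\alpha_n}\right)\le 0$. Here $T^n$ denotes the $n$-th iterate of $T$. *)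

theory Defs
  imports "HOL-Analysis.Analysis"
begin

text \<open>
  The space is the whole of a type of class \<^class>\<open>banach\<close>, passed as a type token.
  The infimum is taken in [0,1] and the supremum in [0,2]: inserting the top element 1,
  respectively the bottom element 0, gives the empty infimum and the empty supremum their
  values there, since \<^const>\<open>Inf\<close> and \<^const>\<open>Sup\<close> of the empty set of reals are
  unspecified. Both insertions matter only for the zero space.
\<close>

definition modulus_of_convexity :: "'a::banach itself \<Rightarrow> real \<Rightarrow> real" where
  "modulus_of_convexity _ \<epsilon> =
     Inf (insert 1 {1 - norm ((1/2) *\<^sub>R (x + y)) | x y :: 'a.
                      norm x \<le> 1 \<and> norm y \<le> 1 \<and> norm (x - y) \<ge> \<epsilon>})"

definition characteristic_of_convexity :: "'a::banach itself \<Rightarrow> real" where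
  "characteristic_of_convexity X =
     Sup (insert 0 {\<epsilon> \<in> {0..2}. modulus_of_convexity X \<epsilon> = 0})"

text \<open>
  The supremum and the limes superior are taken in the extended reals, as the supremum may be
  infinite when \<open>K\<close> is unbounded.
\<close>

definition asymptotically_Holder_nonexpansive_type ::
    "'a::real_normed_vector set \<Rightarrow> ('a \<Rightarrow> 'a) \<Rightarrow> bool" where
  "asymptotically_Holder_nonexpansive_type K T \<longleftrightarrow>
     (\<exists>\<alpha> :: nat \<Rightarrow> real. (\<forall>n. 0 < \<alpha> n \<and> \<alpha> n \<le> 1) \<and> \<alpha> \<longlonglongrightarrow> 1 \<and>
        (\<forall>x\<in>K. limsup (\<lambda>n. SUP y\<in>K.
            ereal (norm ((T ^^ n) x - (T ^^ n) y) - norm (x - y) powr \<alpha> n)) \<le> 0))"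

end

theory Submission
  imports Defs
begin

text \<open>
  Since \<open>t powr a \<le> t + (1 - a)\<close> for \<open>t \<ge> 0\<close> and \<open>0 < a \<le> 1\<close>, a mapping of asymptotically
  Hoelder nonexpansive type satisfies, for each fixed \<open>x\<close> in \<open>K\<close> and each \<open>e > 0\<close>, the
  inequality \<open>norm (T^m x - T^m y) \<le> norm (x - y) + e\<close> for all \<open>y\<close> in \<open>K\<close> once \<open>m\<close> is
  large (\<open>Holder_type_imp_nonexpansive_type\<close>). Apart from the continuity of
  \<open>T^N\<close>, only this property of \<open>T\<close> is used afterwards.

  The condition \<open>\<epsilon>\<^sub>0(X) < 1\<close> yields \<open>c < 1\<close> and \<open>\<delta> > 0\<close> such that two points of the unit ball
  at distance at least \<open>c\<close> have a midpoint of norm at most \<open>1 - \<delta>\<close>. Given \<open>x\<close> with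
  \<open>norm (T^m x - x) \<le> d\<close> for large \<open>m\<close>, let \<open>\<rho> \<le> d\<close> be the asymptotic radius in \<open>K\<close> of the orbit
  of \<open>x\<close>, and let \<open>y\<close> in \<open>K\<close> be an almost optimal asymptotic centre. For large \<open>m\<close> the point
  \<open>T^m y\<close> is almost optimal too, and the midpoint of \<open>y\<close> and \<open>T^m y\<close> cannot beat \<open>\<rho>\<close>; hence
  \<open>norm (T^m y - y)\<close> is at most about \<open>c * \<rho>\<close>. So \<open>x\<close> can be replaced by a point \<open>y\<close> at
  distance at most \<open>3 * d\<close> whose own bound is \<open>q * d\<close>, where \<open>q = (1 + c) / 2 < 1\<close>
  (\<open>asymptotic_displacement_improve\<close>). As centres are only needed up to a positive error,
  no weak compactness enters.

  Iterating gives a Cauchy sequence whose limit \<open>z\<close> satisfies \<open>T^m z \<longlonglongrightarrow> z\<close>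
  (\<open>orbit_convergent_to_start\<close>). Continuity of \<open>T^N\<close> makes \<open>z\<close> a fixed point of \<open>T^N\<close>, so \<open>T z\<close>
  occurs infinitely often in the orbit of \<open>z\<close>, and \<open>T z = z\<close>.
\<close>

section \<open>The characteristic of convexity\<close>

lemma modulus_of_convexity_nonneg: "0 \<le> modulus_of_convexity TYPE('a::banach) \<epsilon>"
  unfolding modulus_of_convexity_def
proof (rule cInf_greatest, goal_cases)
  case (2 r)
  have "norm ((1/2) *\<^sub>R (x + y)) \<le> 1" if "norm x \<le> 1" "norm y \<le> 1" for x y :: 'a
    using norm_triangle_ineq[of x y] that by simp
  with 2 show ?case by auto
qed simp

lemma characteristic_less_one_imp_midpoint_bound:
  assumes "characteristic_of_convexity TYPE('a::banach) < 1"
  obtains c \<delta> where "0 < c" "c < 1" "0 < \<delta>"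
    "\<And>u v :: 'a. norm u \<le> 1 \<Longrightarrow> norm v \<le> 1 \<Longrightarrow> c \<le> norm (u - v)
       \<Longrightarrow> norm ((1/2) *\<^sub>R (u + v)) \<le> 1 - \<delta>"
proof -
  define S where "S = insert 0 {\<epsilon> \<in> {0..2}. modulus_of_convexity TYPE('a) \<epsilon> = 0}"
  define c where "c = (Sup S + 1) / 2"
  have bdd: "bdd_above S" unfolding S_def by (intro bdd_aboveI[of _ 2]) auto
  have "0 \<le> Sup S" using bdd by (intro cSup_upper) (auto simp: S_def)
  moreover have "Sup S < 1"
    using assms by (simp add: S_def characteristic_of_convexity_def)
  ultimately have c: "0 < c" "c < 1" "Sup S < c" by (auto simp: c_def)
  then have "c \<notin> S" using bdd cSup_upper[of c S] by auto
  then have "modulus_of_convexity TYPE('a) c \<noteq> 0" using c by (auto simp: S_def)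
  then have pos: "0 < modulus_of_convexity TYPE('a) c"
    using modulus_of_convexity_nonneg[where 'a='a, of c] by linarith
  have "norm ((1/2) *\<^sub>R (u + v)) \<le> 1 - modulus_of_convexity TYPE('a) c"
    if uv: "norm u \<le> 1" "norm v \<le> 1" "c \<le> norm (u - v)" for u v :: 'a
  proof -
    have le1: "norm ((1/2) *\<^sub>R (x + y)) \<le> 1" if "norm x \<le> 1" "norm y \<le> 1" for x y :: 'a
      using norm_triangle_ineq[of x y] that by simp
    have "modulus_of_convexity TYPE('a) c \<le> 1 - norm ((1/2) *\<^sub>R (u + v))"
      unfolding modulus_of_convexity_def
    proof (rule cInf_lower)
      show "1 - norm ((1/2) *\<^sub>R (u + v)) \<in> insert 1 {1 - norm ((1/2) *\<^sub>R (x + y)) | x y :: 'a.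
          norm x \<le> 1 \<and> norm y \<le> 1 \<and> norm (x - y) \<ge> c}"
        using uv by blast
      show "bdd_below (insert 1 {1 - norm ((1/2) *\<^sub>R (x + y)) | x y :: 'a.
          norm x \<le> 1 \<and> norm y \<le> 1 \<and> norm (x - y) \<ge> c})"
        using le1 by (intro bdd_belowI[of _ 0]) auto
    qed
    then show ?thesis by simp
  qed
  then show thesis using that[of c] c pos by blast
qed

section \<open>Reduction to asymptotically nonexpansive type\<close>

lemma powr_le_add_one_minus:
  fixes t a :: real
  assumes "0 \<le> t" "0 < a" "a \<le> 1"
  shows "t powr a \<le> t + (1 - a)"
proof (cases "t = 0")
  case False
  then have t: "0 < t" using assms by simp
  have "exp ((1 - a) *\<^sub>R 0 + a *\<^sub>R ln t) \<le> (1 - a) * exp 0 + a * exp (ln t)"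
    using convex_onD[OF exp_convex, of a 0 "ln t"] assms by simp
  then have "t powr a \<le> (1 - a) + a * t" using t by (simp add: powr_def)
  also have "\<dots> \<le> t + (1 - a)" using assms t mult_right_mono[of a 1 t] by simp
  finally show ?thesis .
qed (use assms in simp)

lemma Holder_type_imp_nonexpansive_type:
  assumes "asymptotically_Holder_nonexpansive_type K T" "x \<in> K" "0 < e"
  shows "\<forall>\<^sub>F m in sequentially. \<forall>y\<in>K. norm ((T ^^ m) x - (T ^^ m) y) \<le> norm (x - y) + e"
proof -
  obtain \<alpha> :: "nat \<Rightarrow> real" where \<alpha>: "\<And>n. 0 < \<alpha> n" "\<And>n. \<alpha> n \<le> 1" "\<alpha> \<longlonglongrightarrow> 1"
    and lim: "limsup (\<lambda>n. SUP y\<in>K.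
            ereal (norm ((T ^^ n) x - (T ^^ n) y) - norm (x - y) powr \<alpha> n)) \<le> 0"
    using assms unfolding asymptotically_Holder_nonexpansive_type_def by blast
  have "\<forall>\<^sub>F n in sequentially. (SUP y\<in>K.
            ereal (norm ((T ^^ n) x - (T ^^ n) y) - norm (x - y) powr \<alpha> n)) < ereal (e/2)"
    using \<open>0 < e\<close> by (intro Limsup_lessD le_less_trans[OF lim]) simp
  moreover have "\<forall>\<^sub>F n in sequentially. 1 - e/2 < \<alpha> n"
    using \<alpha>(3) \<open>0 < e\<close> by (intro order_tendstoD(1)) auto
  ultimately show ?thesis
  proof eventually_elim
    case (elim n)
    show ?case
    proof
      fix y assume "y \<in> K"
      have "ereal (norm ((T ^^ n) x - (T ^^ n) y) - norm (x - y) powr \<alpha> n) < ereal (e/2)"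
        using elim(1) \<open>y \<in> K\<close> by (meson SUP_upper le_less_trans)
      moreover have "norm (x - y) powr \<alpha> n \<le> norm (x - y) + (1 - \<alpha> n)"
        by (intro powr_le_add_one_minus \<alpha>) simp
      ultimately show "norm ((T ^^ n) x - (T ^^ n) y) \<le> norm (x - y) + e"
        using elim(2) by simp
    qed
  qed
qed

section \<open>Almost optimal asymptotic centres of orbits\<close>

lemma funpow_mem: "T \<in> K \<rightarrow> K \<Longrightarrow> x \<in> K \<Longrightarrow> (T ^^ n) x \<in> K"
  by (induction n) auto

text \<open>
  One step of the iteration: the bound \<open>d\<close> on the eventual displacement of \<open>x\<close> along its orbit
  is improved by the factor \<open>(1 + c) / 2\<close>. The set \<open>S\<close> below collects the radii of balls that
  are centred in \<open>K\<close> and contain the orbit of \<open>x\<close> eventually.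
\<close>

lemma asymptotic_displacement_improve:
  fixes K :: "'a::real_normed_vector set"
  assumes c: "0 < c" "c < 1" and \<delta>: "0 < \<delta>"
    and mid: "\<And>u v :: 'a. norm u \<le> 1 \<Longrightarrow> norm v \<le> 1 \<Longrightarrow> c \<le> norm (u - v)
                \<Longrightarrow> norm ((1/2) *\<^sub>R (u + v)) \<le> 1 - \<delta>"
    and "convex K" and T: "T \<in> K \<rightarrow> K"
    and nonexp: "\<And>x e. x \<in> K \<Longrightarrow> 0 < e \<Longrightarrow> \<forall>\<^sub>F m in sequentially.
                   \<forall>y\<in>K. norm ((T ^^ m) x - (T ^^ m) y) \<le> norm (x - y) + e"
    and x: "x \<in> K" and d: "0 < d" "\<forall>\<^sub>F m in sequentially. norm ((T ^^ m) x - x) \<le> d"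
  shows "\<exists>y\<in>K. norm (y - x) \<le> 3 * d \<and>
           (\<forall>\<^sub>F m in sequentially. norm ((T ^^ m) y - y) \<le> (1 + c) / 2 * d)"
proof -
  define S where "S = {r. \<exists>y\<in>K. \<forall>\<^sub>F i in sequentially. norm ((T ^^ i) x - y) \<le> r}"
  define \<rho> where "\<rho> = Inf S"
  have S_nonneg: "0 \<le> r" if r: "r \<in> S" for r
  proof -
    obtain y where "\<forall>\<^sub>F i in sequentially. norm ((T ^^ i) x - y) \<le> r"
      using r by (auto simp: S_def)
    then obtain i where "norm ((T ^^ i) x - y) \<le> r" by (auto simp: eventually_sequentially)
    then show ?thesis using norm_ge_zero order_trans by blast
  qed
  have dS: "d \<in> S" using x d by (auto simp: S_def)
  have \<rho>_le: "\<rho> \<le> r" if "r \<in> S" for r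
    unfolding \<rho>_def using that S_nonneg by (intro cInf_lower bdd_belowI[of _ 0]) auto
  have \<rho>: "0 \<le> \<rho>" "\<rho> \<le> d"
    using dS S_nonneg \<rho>_le by (auto simp: \<rho>_def intro!: cInf_greatest)
  \<comment> \<open>The error \<open>\<eta>\<close> is small against \<open>d\<close>, and small enough against \<open>\<rho>\<close> for the midpoint to have an
      asymptotic radius below \<open>\<rho>\<close>; for \<open>\<rho> = 0\<close> the triangle inequality alone suffices.\<close>
  define \<eta> where "\<eta> = (if \<rho> = 0 then d / 8 else min (\<delta> * \<rho> / 4) ((1 - c) * d / 4))"
  have \<eta>: "0 < \<eta>" using \<rho> d c \<delta> by (auto simp: \<eta>_def)
  define R where "R = \<rho> + 2 * \<eta>"
  have R: "0 < R" using \<eta> \<rho> by (simp add: R_def)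
  have \<eta>_le: "\<eta> \<le> d"
  proof (cases "\<rho> = 0")
    case False
    have "(1 - c) * d \<le> 1 * d" using c d by (intro mult_right_mono) auto
    moreover have "\<eta> \<le> (1 - c) * d / 4" using False by (simp add: \<eta>_def)
    ultimately show ?thesis using d by linarith
  qed (use d in \<open>simp add: \<eta>_def\<close>)
  have "\<exists>r\<in>S. r < \<rho> + \<eta>"
    using dS \<eta> cInf_lessD[of S "\<rho> + \<eta>"] by (auto simp: \<rho>_def)
  then obtain r y where "r < \<rho> + \<eta>" and y: "y \<in> K"
    "\<forall>\<^sub>F i in sequentially. norm ((T ^^ i) x - y) \<le> r"
    unfolding S_def by blast
  have y_centre: "\<forall>\<^sub>F i in sequentially. norm ((T ^^ i) x - y) \<le> \<rho> + \<eta>"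
    using y(2) by eventually_elim (use \<open>r < \<rho> + \<eta>\<close> in simp)
  have "\<forall>\<^sub>F i in sequentially. norm (y - x) \<le> 3 * d"
    using y_centre d(2)
  proof eventually_elim
    case (elim i)
    have "norm (y - x) \<le> norm ((T ^^ i) x - x) + norm ((T ^^ i) x - y)"
      using norm_triangle_ineq4[of "(T ^^ i) x - x" "(T ^^ i) x - y"] by simp
    then show ?case using elim \<rho> \<eta>_le by simp
  qed
  then have "norm (y - x) \<le> 3 * d" by (simp add: eventually_const)
  moreover have "\<forall>\<^sub>F m in sequentially. norm ((T ^^ m) y - y) \<le> (1 + c) / 2 * d"
    using nonexp[OF y(1) \<eta>]
  proof eventually_elim
    case (elim m)
    note near = elim
    have "\<forall>\<^sub>F i in sequentially. norm ((T ^^ (i + m)) x - (T ^^ m) y) \<le> R"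
      using y_centre
    proof eventually_elim
      case (elim i)
      have "norm ((T ^^ m) y - (T ^^ m) ((T ^^ i) x)) \<le> norm (y - (T ^^ i) x) + \<eta>"
        using near funpow_mem[OF T x] by blast
      then show ?case using elim
        by (simp add: R_def norm_minus_commute funpow_add add.commute[of i m])
    qed
    then have Tm: "\<forall>\<^sub>F i in sequentially. norm ((T ^^ i) x - (T ^^ m) y) \<le> R"
      by (subst (asm) eventually_sequentially_seg)
    have y': "\<forall>\<^sub>F i in sequentially. norm ((T ^^ i) x - y) \<le> R"
      using y_centre by eventually_elim (use \<eta> in \<open>simp add: R_def\<close>)
    show ?case
    proof (cases "\<rho> = 0")
      case True
      have "\<forall>\<^sub>F i in sequentially. norm ((T ^^ m) y - y) \<le> 2 * R"
        using Tm y'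
      proof eventually_elim
        case (elim i)
        then show ?case
          using norm_triangle_ineq4[of "(T ^^ i) x - y" "(T ^^ i) x - (T ^^ m) y"] by simp
      qed
      then have "norm ((T ^^ m) y - y) \<le> 2 * R" by (simp add: eventually_const)
      also have "2 * R = 1 / 2 * d" using True by (simp add: R_def \<eta>_def)
      also have "\<dots> \<le> (1 + c) / 2 * d" using c d by (intro mult_right_mono) auto
      finally show ?thesis .
    next
      case False
      have less: "norm (y - (T ^^ m) y) < c * R"
      proof (rule ccontr)
        assume "\<not> norm (y - (T ^^ m) y) < c * R"
        then have far: "c \<le> norm (y - (T ^^ m) y) / R" using R by (simp add: field_simps)
        define w where "w = (1/2) *\<^sub>R y + (1/2) *\<^sub>R (T ^^ m) y"
        have "w \<in> K" unfolding w_def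
          using \<open>convex K\<close> y(1) funpow_mem[OF T y(1)] by (intro convexD) auto
        moreover have "\<forall>\<^sub>F i in sequentially. norm ((T ^^ i) x - w) \<le> (1 - \<delta>) * R"
          using Tm y'
        proof eventually_elim
          case (elim i)
          define u where "u = (1 / R) *\<^sub>R ((T ^^ i) x - y)"
          define v where "v = (1 / R) *\<^sub>R ((T ^^ i) x - (T ^^ m) y)"
          have "u - v = (1 / R) *\<^sub>R ((T ^^ m) y - y)"
            by (simp add: u_def v_def algebra_simps)
          then have "c \<le> norm (u - v)"
            using far R by (simp add: norm_minus_commute)
          moreover have "norm u \<le> 1" "norm v \<le> 1"
            using elim R by (auto simp: u_def v_def)
          ultimately have "norm ((1/2) *\<^sub>R (u + v)) \<le> 1 - \<delta>" by (intro mid)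
          moreover have "(1/2) *\<^sub>R (u + v) = (1 / R) *\<^sub>R ((T ^^ i) x - w)"
          proof -
            have "u + v = (1 / R) *\<^sub>R (2 *\<^sub>R ((T ^^ i) x - w))"
              unfolding u_def v_def w_def scaleR_add_right[symmetric]
              by (rule arg_cong[of _ _ "(*\<^sub>R) (1 / R)"]) (simp add: algebra_simps scaleR_2)
            then show ?thesis by simp
          qed
          ultimately have "norm ((1 / R) *\<^sub>R ((T ^^ i) x - w)) \<le> 1 - \<delta>" by (simp only:)
          then have "norm ((T ^^ i) x - w) / R \<le> 1 - \<delta>"
            unfolding norm_scaleR using R by simp
          then show ?case using R by (simp add: pos_divide_le_eq)
        qed
        ultimately have "(1 - \<delta>) * R \<in> S" by (auto simp: S_def)
        then have "\<rho> \<le> (1 - \<delta>) * R" by (rule \<rho>_le)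
        also have "\<dots> = R - \<delta> * \<rho> - 2 * (\<delta> * \<eta>)" by (simp add: R_def algebra_simps)
        also have "\<dots> < R - \<delta> * \<rho>" using \<delta> \<eta> by simp
        also have "\<dots> \<le> \<rho> - \<delta> * \<rho> / 2" using False by (simp add: R_def \<eta>_def)
        finally show False using \<delta> \<rho> by (simp add: mult_less_0_iff)
      qed
      have "c * R \<le> c * d + 2 * \<eta>"
      proof -
        have "c * \<rho> \<le> c * d" using \<rho>(2) c by (intro mult_left_mono) auto
        moreover have "c * \<eta> \<le> 1 * \<eta>" using c \<eta> by (intro mult_right_mono) auto
        ultimately show ?thesis by (simp add: R_def algebra_simps)
      qed
      also have "\<dots> \<le> c * d + (1 - c) * d / 2" using False by (simp add: \<eta>_def)
      also have "\<dots> = (1 + c) / 2 * d" by (simp add: field_simps)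
      finally show ?thesis using less by (simp add: norm_minus_commute)
    qed
  qed
  ultimately show ?thesis using y(1) by blast
qed

section \<open>A point whose orbit converges to it, and fixed points\<close>

lemma convergent_if_geometric_steps:
  fixes f :: "nat \<Rightarrow> 'a::banach"
  assumes "\<And>n. norm (f (Suc n) - f n) \<le> B * q ^ n" "0 \<le> q" "q < 1"
  shows "convergent f"
proof -
  have "summable (\<lambda>n. B * q ^ n)" using assms by (intro summable_mult summable_geometric) simp
  then have "summable (\<lambda>n. f (Suc n) - f n)"
    using assms(1) by (rule summable_comparison_test'[where N = 0])
  then have "convergent (\<lambda>n. f n - f 0)"
    by (simp add: summable_iff_convergent sum_lessThan_telescope)
  then show ?thesis by (simp add: convergent_diff_const_right_iff)
qed

lemma orbit_convergent_to_start:
  fixes K :: "'a::banach set"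
  assumes "characteristic_of_convexity TYPE('a) < 1"
    and "K \<noteq> {}" "closed K" "bounded K" "convex K" and T: "T \<in> K \<rightarrow> K"
    and nonexp: "\<And>x e. x \<in> K \<Longrightarrow> 0 < e \<Longrightarrow> \<forall>\<^sub>F m in sequentially.
                   \<forall>y\<in>K. norm ((T ^^ m) x - (T ^^ m) y) \<le> norm (x - y) + e"
  obtains z where "z \<in> K" "(\<lambda>m. (T ^^ m) z) \<longlonglongrightarrow> z"
proof -
  obtain c \<delta> where c: "0 < c" "c < 1" and \<delta>: "0 < \<delta>" and
    mid: "\<And>u v :: 'a. norm u \<le> 1 \<Longrightarrow> norm v \<le> 1 \<Longrightarrow> c \<le> norm (u - v)
       \<Longrightarrow> norm ((1/2) *\<^sub>R (u + v)) \<le> 1 - \<delta>"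
    using characteristic_less_one_imp_midpoint_bound[OF assms(1)] by blast
  define q where "q = (1 + c) / 2"
  have q: "0 < q" "q < 1" using c by (auto simp: q_def)
  obtain x0 where x0: "x0 \<in> K" using \<open>K \<noteq> {}\<close> by blast
  obtain D where D: "0 < D" "\<And>x. x \<in> K \<Longrightarrow> norm x \<le> D"
    using \<open>bounded K\<close> by (auto simp: bounded_pos)
  define P where "P n x \<longleftrightarrow> x \<in> K \<and>
    (\<forall>\<^sub>F m in sequentially. norm ((T ^^ m) x - x) \<le> 2 * D * q ^ n)" for n x
  have "\<exists>f. \<forall>n. P n (f n) \<and> norm (f (Suc n) - f n) \<le> 3 * (2 * D * q ^ n)"
  proof (rule dependent_nat_choice)
    have "norm ((T ^^ m) x0 - x0) \<le> 2 * D" for m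
      using norm_triangle_ineq4[of "(T ^^ m) x0" x0] D(2)[OF x0] D(2)[OF funpow_mem[OF T x0], of m]
      by simp
    then show "\<exists>x. P 0 x" using x0 by (auto simp: P_def)
  next
    fix x n assume "P n x"
    then show "\<exists>y. P (Suc n) y \<and> norm (y - x) \<le> 3 * (2 * D * q ^ n)"
      using asymptotic_displacement_improve[OF c \<delta> mid \<open>convex K\<close> T nonexp, of x "2 * D * q ^ n"]
        q D(1) unfolding P_def q_def[symmetric] by (auto simp: mult_ac)
  qed
  then obtain f where f: "\<And>n. P n (f n)" "\<And>n. norm (f (Suc n) - f n) \<le> 3 * (2 * D * q ^ n)"
    by blast
  have "convergent f"
    using f(2) q by (intro convergent_if_geometric_steps[of f "6 * D" q]) (auto simp: mult_ac)
  then obtain z where z: "f \<longlonglongrightarrow> z" by (auto simp: convergent_def)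
  have "z \<in> K" using \<open>closed K\<close> z f(1) closed_sequentially[of K f z] by (auto simp: P_def)
  moreover have "(\<lambda>m. (T ^^ m) z) \<longlonglongrightarrow> z"
    unfolding tendsto_iff dist_norm
  proof (intro allI impI)
    fix e :: real assume "0 < e"
    have "(\<lambda>n. 2 * D * q ^ n) \<longlonglongrightarrow> 2 * D * 0"
      using q by (intro tendsto_mult_left LIMSEQ_power_zero) auto
    then have "\<forall>\<^sub>F n in sequentially. 2 * D * q ^ n < e / 4"
      using \<open>0 < e\<close> by (intro order_tendstoD(2)) auto
    moreover have "\<forall>\<^sub>F n in sequentially. norm (f n - z) < e / 4"
      using tendstoD[OF z, of "e / 4"] \<open>0 < e\<close> by (simp add: dist_norm)
    ultimately have "\<forall>\<^sub>F n in sequentially. 2 * D * q ^ n < e / 4 \<and> norm (f n - z) < e / 4"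
      by (rule eventually_conj)
    then obtain n where n: "2 * D * q ^ n < e / 4" "norm (f n - z) < e / 4"
      by (auto simp: eventually_sequentially)
    have fn: "f n \<in> K" "\<forall>\<^sub>F m in sequentially. norm ((T ^^ m) (f n) - f n) \<le> 2 * D * q ^ n"
      using f(1)[of n] by (auto simp: P_def)
    have "\<forall>\<^sub>F m in sequentially. \<forall>y\<in>K. norm ((T ^^ m) z - (T ^^ m) y) \<le> norm (z - y) + e / 4"
      using nonexp[OF \<open>z \<in> K\<close>] \<open>0 < e\<close> by simp
    with fn(2) show "\<forall>\<^sub>F m in sequentially. norm ((T ^^ m) z - z) < e"
    proof eventually_elim
      case (elim m)
      have "norm ((T ^^ m) z - (T ^^ m) (f n)) \<le> norm (f n - z) + e / 4"
        using elim(2) fn(1) norm_minus_commute[of z "f n"] by fastforce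
      moreover have "norm ((T ^^ m) z - z) \<le> norm ((T ^^ m) z - (T ^^ m) (f n))
          + norm ((T ^^ m) (f n) - f n) + norm (f n - z)"
        using norm_triangle_ineq[of "(T ^^ m) z - (T ^^ m) (f n)" "(T ^^ m) (f n) - f n"]
          norm_triangle_ineq[of "(T ^^ m) z - f n" "f n - z"] by simp
      ultimately show ?case using elim(1) n by linarith
    qed
  qed
  ultimately show thesis by (rule that)
qed

lemma fixpoint_if_orbit_converges_to_start:
  fixes T :: "'a::t2_space \<Rightarrow> 'a"
  assumes T: "T \<in> K \<rightarrow> K" and "z \<in> K" and lim: "(\<lambda>m. (T ^^ m) z) \<longlonglongrightarrow> z"
    and "N \<ge> 1" and cont: "continuous_on K (T ^^ N)"
  shows "T z = z"
proof -
  have "(\<lambda>m. (T ^^ N) ((T ^^ m) z)) \<longlonglongrightarrow> (T ^^ N) z"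
    by (rule continuous_on_tendsto_compose[OF cont lim \<open>z \<in> K\<close>])
      (simp add: funpow_mem[OF T \<open>z \<in> K\<close>])
  moreover have "(\<lambda>m. (T ^^ N) ((T ^^ m) z)) \<longlonglongrightarrow> z"
    using LIMSEQ_ignore_initial_segment[OF lim, of N] by (simp add: add.commute[of _ N] funpow_add)
  ultimately have fixN: "(T ^^ N) z = z" by (rule LIMSEQ_unique)
  have "(T ^^ (k * N)) z = z" for k
    by (induction k) (simp_all add: funpow_add fixN)
  then have const: "(T ^^ Suc (k * N)) z = T z" for k by simp
  have "strict_mono (\<lambda>k. Suc (k * N))" using \<open>N \<ge> 1\<close> by (auto simp: strict_mono_def)
  then have "(\<lambda>k. (T ^^ Suc (k * N)) z) \<longlonglongrightarrow> z"
    using LIMSEQ_subseq_LIMSEQ[OF lim, of "\<lambda>k. Suc (k * N)"] by (simp only: o_def)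
  then show ?thesis unfolding const by (simp add: LIMSEQ_const_iff)
qed

theorem mainTheorem2:
  fixes K :: "'a::banach set" and T :: "'a \<Rightarrow> 'a" and N :: nat
  assumes "characteristic_of_convexity TYPE('a) < 1"
    and "K \<noteq> {}" and "closed K" and "bounded K" and "convex K"
    and "T \<in> K \<rightarrow> K"
    and "asymptotically_Holder_nonexpansive_type K T"
    and "N \<ge> 1" and "continuous_on K (T ^^ N)"
  shows "\<exists>x\<in>K. T x = x"
proof -
  obtain z where "z \<in> K" "(\<lambda>m. (T ^^ m) z) \<longlonglongrightarrow> z"
    using orbit_convergent_to_start[OF assms(1-6) Holder_type_imp_nonexpansive_type[OF assms(7)]]
    by blast
  then show ?thesis
    using fixpoint_if_orbit_converges_to_start[OF assms(6) _ _ assms(8,9)] by blast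
qed

end
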